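(* If $T$ is a tree that is not a caterpillar, then the class of $T$-pivot-minor-free distance-hereditary graphs has unbounded linear rank-width; that is, there is no constant $c$ such that every $T$-pivot-minor-free distance-hereditary graph has linear rank-width at most $c$.
   Context: All graphs are finite, without loops or multiple edges. A caterpillar is a tree that contains a path $P$ such that every vertex not on $P$ has a neighbour in $P$. A graph $G$ is distance-hereditary if for every connected induced subgraph $H$ of $G$ and every two vertices $v,w$ of $H$, the distance between $v$ and $w$ in $H$ is the same as the distance in $G$. The local complementation at a vertex $u$ of $G$ replaces every edge of the subgraph induced by the neighbours of $u$ with a non-edge, and vice versa; the result is denoted $G*u$. Pivoting an edge $uv$ of $G$ gives $G\wedge uv = G*u*v*u$. A graph $H$ is a pivot-minor of $G$ if $H$ can be obtained from $G$ by a sequence of edge pivots and vertex deletions. A graph is $T$-pivot-minor-free if it has no pivot-minor isomorphic to $T$. For a graph $G$ with adjacency matrix $A_G$ and $X\subseteq V(G)$, let $\mathrm{cutrk}_G(X)$ be the rank over the binary field of the submatrix $A_G[X,V(G)\setminus X]$ with rows $X$ and columns $V(G)\setminus X$. The width of a linear ordering $(x_1,\ldots,x_n)$ of $V(G)$ is $\max_{1\le i\le n}\mathrm{cutrk}_G(\{x_1,\ldots,x_i\})$. The linear rank-width of $G$ is the minimum width over all linear orderings of $V(G)$. *)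

theory Defs
  imports
    "HOL-Library.Z2"
    "HOL-Library.Function_Algebras"
    "HOL-Combinatorics.Multiset_Permutations"
    "Graph_Theory.Graph_Theory"
begin

text \<open>
  A finite graph without loops or multiple edges is a \<^locale>\<open>pair_graph\<close>: a finite
  vertex set together with a finite, symmetric, irreflexive adjacency relation on it.
\<close>

section \<open>Trees and caterpillars\<close>

text \<open>
  The library predicates \<open>forest\<close> and \<open>tree\<close> count the directed walk \<open>u, v, u\<close> as a cycle and
  so reject every symmetric digraph that has an edge. Cycles are therefore taken here in
  the undirected sense, with at least three distinct vertices.
\<close>

definition is_cycle :: "'a pair_pre_digraph \<Rightarrow> 'a list \<Rightarrow> bool" where
  "is_cycle G p \<longleftrightarrow> vpath p (with_proj G) \<and> length p \<ge> 3 \<and> (last p, hd p) \<in> parcs G"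

definition is_tree :: "'a pair_pre_digraph \<Rightarrow> bool" where
  "is_tree G \<longleftrightarrow>
     pair_graph G \<and> Digraph_Component.connected (with_proj G) \<and> \<not> (\<exists>p. is_cycle G p)"

definition is_caterpillar :: "'a pair_pre_digraph \<Rightarrow> bool" where
  "is_caterpillar G \<longleftrightarrow>
     is_tree G \<and>
     (\<exists>p. vpath p (with_proj G) \<and> (\<forall>v \<in> pverts G - set p. \<exists>w \<in> set p. (v, w) \<in> parcs G))"


section \<open>Distance-hereditary graphs\<close>

text \<open>The distance is infinite for vertices in different components.\<close>

definition distance :: "'a pair_pre_digraph \<Rightarrow> 'a \<Rightarrow> 'a \<Rightarrow> ereal" where
  "distance G v w = wf_digraph.\<mu> (with_proj G) (\<lambda>_. 1) v w"

definition distance_hereditary :: "'a pair_pre_digraph \<Rightarrow> bool" where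
  "distance_hereditary G \<longleftrightarrow>
     (\<forall>H. induced_subgraph (with_proj H) (with_proj G) \<and> Digraph_Component.connected (with_proj H) \<longrightarrow>
        (\<forall>v \<in> pverts H. \<forall>w \<in> pverts H. distance H v w = distance G v w))"


section \<open>Pivot-minors\<close>

definition local_complement :: "'a pair_pre_digraph \<Rightarrow> 'a \<Rightarrow> 'a pair_pre_digraph" where
  "local_complement G u =
     \<lparr> pverts = pverts G,
       parcs = {(x, y). ((x, y) \<in> parcs G) \<noteq> (x \<noteq> y \<and> (u, x) \<in> parcs G \<and> (u, y) \<in> parcs G)} \<rparr>"

definition pivot :: "'a pair_pre_digraph \<Rightarrow> 'a \<Rightarrow> 'a \<Rightarrow> 'a pair_pre_digraph" where
  "pivot G u v = local_complement (local_complement (local_complement G u) v) u"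

definition delete_vertex :: "'a pair_pre_digraph \<Rightarrow> 'a \<Rightarrow> 'a pair_pre_digraph" where
  "delete_vertex G v =
     \<lparr> pverts = pverts G - {v}, parcs = {e \<in> parcs G. fst e \<noteq> v \<and> snd e \<noteq> v} \<rparr>"

lemma with_proj_delete_vertex:
  "with_proj (delete_vertex G v) = pre_digraph.del_vert (with_proj G) v"
  by (simp add: delete_vertex_def with_proj_def pre_digraph.del_vert_def)

lemma pair_graph_local_complement:
  assumes "pair_graph G"
  shows "pair_graph (local_complement G u)"
proof -
  interpret G: pair_graph G by fact
  let ?H = "local_complement G u"
  have sub: "parcs ?H \<subseteq> pverts G \<times> pverts G"
    by (auto simp: local_complement_def dest: G.in_arcsD1 G.in_arcsD2)
  show ?thesis
  proof
    show "finite (pverts ?H)"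
      by (simp add: local_complement_def G.pair_finite_verts)
    show "finite (parcs ?H)"
      using sub by (rule finite_subset) (simp add: G.pair_finite_verts)
    show "symmetric (with_proj ?H)"
      by (auto simp: symmetric_def local_complement_def intro!: symI dest: G.arcs_symmetric)
    show "fst e \<in> pverts ?H" "snd e \<in> pverts ?H" if "e \<in> parcs ?H" for e
      using that sub by (auto simp: local_complement_def)
    show "fst e \<noteq> snd e" if "e \<in> parcs ?H" for e
      using that by (auto simp: local_complement_def dest: G.no_loops')
  qed
qed

inductive pivot_minor :: "'a pair_pre_digraph \<Rightarrow> 'a pair_pre_digraph \<Rightarrow> bool" where
  refl: "pivot_minor G G"
| pivot: "pivot_minor H G \<Longrightarrow> (u, v) \<in> parcs H \<Longrightarrow> pivot_minor (pivot H u v) G"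
| delete: "pivot_minor H G \<Longrightarrow> v \<in> pverts H \<Longrightarrow> pivot_minor (delete_vertex H v) G"

definition pivot_minor_free :: "'b pair_pre_digraph \<Rightarrow> 'a pair_pre_digraph \<Rightarrow> bool" where
  "pivot_minor_free T G \<longleftrightarrow>
     \<not> (\<exists>H. pivot_minor H G \<and> digraph_iso (with_proj H) (with_proj T))"


section \<open>Linear rank-width\<close>

definition adj_matrix :: "'a pair_pre_digraph \<Rightarrow> 'a \<Rightarrow> 'a \<Rightarrow> bit" where
  "adj_matrix G u v = (if (u, v) \<in> parcs G then 1 else 0)"

lemma vector_space_fun: "vector_space (\<lambda>(c :: 'k::field) (f :: 'a \<Rightarrow> 'k) x. c * f x)"
  by standard (auto simp: fun_eq_iff algebra_simps)

text \<open>
  The rank of the submatrix of \<open>M\<close> with row set \<open>R\<close> and column set \<open>C\<close>, as the dimension of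
  its row space. A vector indexed by \<open>C\<close> is represented by its extension by zero.
\<close>

definition submatrix_rank :: "'r set \<Rightarrow> 'c set \<Rightarrow> ('r \<Rightarrow> 'c \<Rightarrow> 'k::field) \<Rightarrow> nat" where
  "submatrix_rank R C M =
     vector_space.dim (\<lambda>(c :: 'k) (f :: 'c \<Rightarrow> 'k) x. c * f x)
       ((\<lambda>r c. if c \<in> C then M r c else 0) ` R)"

definition cutrk :: "'a pair_pre_digraph \<Rightarrow> 'a set \<Rightarrow> nat" where
  "cutrk G X = submatrix_rank X (pverts G - X) (adj_matrix G)"

text \<open>The inserted \<open>0\<close> only matters for the null graph, whose width is \<open>0\<close>.\<close>

definition ordering_width :: "'a pair_pre_digraph \<Rightarrow> 'a list \<Rightarrow> nat" where
  "ordering_width G xs = Max (insert 0 ((\<lambda>i. cutrk G (set (take i xs))) ` {1..length xs}))"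

definition linear_rank_width :: "'a pair_pre_digraph \<Rightarrow> nat" where
  "linear_rank_width G = Min (ordering_width G ` permutations_of_set (pverts G))"

end

theory Submission
  imports Defs "HOL-Library.Sublist"
begin

text \<open>
  The extremal graphs are the incomparability graphs of the complete ternary trees, that is,
  words over a three-letter alphabet, adjacent when neither is a prefix of the other. These are
  cographs, hence distance-hereditary. Call a partition of the vertex set uniform if the edges
  between different parts are exactly those within some fixed vertex set \<open>f\<close>. Pivoting and vertex
  deletion preserve uniformity (with a new \<open>f\<close>), and every node of the tree induces a uniform
  partition into the branches below it and the rest. These partitions survive in every pivot-minor
  and rule out an induced claw with all edges subdivided, whereas every tree that is not a
  caterpillar contains one. For the linear rank-width, every second level of the tree yields one
  more distinct row in some cut of any ordering: of three sibling subtrees, the one that reaches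
  many distinct rows as the second sees an earlier vertex of one sibling and a later vertex of
  another.
\<close>

section \<open>Uniform partitions and pivot-minors\<close>

text \<open>The parts are the fibres of \<open>p\<close>; every cut along a union of parts then has
  cut-rank at most one. The set \<open>f\<close> is existential because pivots change it, while
  \<open>p\<close> stays fixed.\<close>

definition uniform_partition :: "'a pair_pre_digraph \<Rightarrow> ('a \<Rightarrow> 'p) \<Rightarrow> bool" where
  "uniform_partition G p \<longleftrightarrow>
     (\<exists>f. \<forall>x y. p x \<noteq> p y \<longrightarrow> ((x, y) \<in> parcs G \<longleftrightarrow> f x \<and> f y))"

lemma pair_graph_delete_vertex:
  assumes "pair_graph G"
  shows "pair_graph (delete_vertex G v)"
proof -
  interpret G: pair_graph G by fact
  show ?thesis
  proof
    show "finite (pverts (delete_vertex G v))" "finite (parcs (delete_vertex G v))"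
      by (simp_all add: delete_vertex_def G.pair_finite_verts G.pair_finite_arcs)
    show "symmetric (with_proj (delete_vertex G v))"
      by (auto simp: symmetric_def delete_vertex_def intro!: symI dest: G.arcs_symmetric)
    show "fst e \<in> pverts (delete_vertex G v)" "snd e \<in> pverts (delete_vertex G v)"
      "fst e \<noteq> snd e" if "e \<in> parcs (delete_vertex G v)" for e
      using that G.arc_fst_in_verts G.arc_snd_in_verts G.pair_no_loops
      by (auto simp: delete_vertex_def)
  qed
qed

lemma pair_graph_pivot_minor:
  assumes "pivot_minor H G" and "pair_graph G"
  shows "pair_graph H"
  using assms
  by induction (simp_all add: pivot_def pair_graph_local_complement pair_graph_delete_vertex)

text \<open>Closed form of pivoting: the roles of \<open>u\<close> and \<open>v\<close> are
  exchanged, and away from them two products are added to the old entry. Inequality of truth values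
  is addition over the binary field.\<close>

lemma parcs_pivot:
  assumes "pair_graph G" and uv: "(u, v) \<in> parcs G"
  shows "(x, y) \<in> parcs (pivot G u v) \<longleftrightarrow>
    (let A = (\<lambda>x y. (x, y) \<in> parcs G);
         s = (\<lambda>x. if x = u then v else if x = v then u else x)
     in if x \<in> {u, v} \<or> y \<in> {u, v} then A (s x) (s y)
        else (A x y \<noteq> (A x u \<and> A y v)) \<noteq> (A x v \<and> A y u))"
proof -
  interpret G: pair_graph G by fact
  have irr: "(a, a) \<notin> parcs G" for a
    using G.no_loops' by auto
  have sym: "(b, a) \<in> parcs G \<longleftrightarrow> (a, b) \<in> parcs G" for a b
    using G.arcs_symmetric by blast
  have neq: "u \<noteq> v"
    using uv irr by blast
  note facts = neq neq[symmetric] uv irr sym[of u x] sym[of v x] sym[of u y] sym[of v y]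
    sym[of x y] sym[of v u]
  consider "x = u" "y = u" | "x = u" "y = v" | "x = u" "y \<noteq> u" "y \<noteq> v"
    | "x = v" "y = u" | "x = v" "y = v" | "x = v" "y \<noteq> u" "y \<noteq> v"
    | "x \<noteq> u" "x \<noteq> v" "y = u" | "x \<noteq> u" "x \<noteq> v" "y = v"
    | "x \<noteq> u" "x \<noteq> v" "y \<noteq> u" "y \<noteq> v"
    by blast
  then show ?thesis
    unfolding pivot_def local_complement_def Let_def
    by cases (simp_all add: facts, (auto simp: facts)?)
qed

text \<open>Between parts the adjacency factors through \<open>f\<close>, and the products added by
  the pivot keep it factored. The new \<open>f\<close> is explicit, with separate formulas for an
  edge inside a part and an edge between two parts.\<close>

lemma uniform_partition_pivot:
  assumes G: "pair_graph G" and uv: "(u, v) \<in> parcs G" and "uniform_partition G p"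
  shows "uniform_partition (pivot G u v) p"
proof -
  interpret G: pair_graph G by fact
  let ?A = "\<lambda>x y. (x, y) \<in> parcs G"
  obtain f where f: "\<And>x y. p x \<noteq> p y \<Longrightarrow> ?A x y \<longleftrightarrow> f x \<and> f y"
    using assms(3) unfolding uniform_partition_def by blast
  have sym: "?A b a \<longleftrightarrow> ?A a b" for a b
    using G.arcs_symmetric by blast
  have "u \<noteq> v"
    using uv G.no_loops' by auto
  note piv = parcs_pivot[OF G uv, unfolded Let_def]
  show ?thesis
  proof (cases "p u = p v")
    case True
    \<comment> \<open>For \<open>x\<close> in the part of \<open>u\<close> and \<open>v\<close> and
      \<open>y\<close> elsewhere, \<open>?A y u\<close> and \<open>?A y v\<close> both contain the
      factor \<open>f y\<close>, and this expression is what multiplies it. If both lie elsewhere,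
      the two added products cancel.\<close>
    define f' where "f' x = (if x = u then f v else if x = v then f u else
      if p x = p u then (f x \<noteq> (f u \<and> ?A x v)) \<noteq> (f v \<and> ?A x u) else f x)" for x
    have "(x, y) \<in> parcs (pivot G u v) \<longleftrightarrow> f' x \<and> f' y" if xy: "p x \<noteq> p y" for x y
    proof -
      consider "x = u" | "x = v" | "x \<noteq> u" "x \<noteq> v" "y = u" | "x \<noteq> u" "x \<noteq> v" "y = v"
        | "x \<noteq> u" "x \<noteq> v" "y \<noteq> u" "y \<noteq> v"
        by blast
      then show ?thesis
      proof cases
        case 1
        then show ?thesis
          using xy True \<open>u \<noteq> v\<close> f[of v y] unfolding piv f'_def by auto
      next
        case 2
        then show ?thesis
          using xy True \<open>u \<noteq> v\<close> f[of u y] unfolding piv f'_def by auto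
      next
        case 3
        then show ?thesis
          using xy True \<open>u \<noteq> v\<close> f[of x v] unfolding piv f'_def by auto
      next
        case 4
        then show ?thesis
          using xy True \<open>u \<noteq> v\<close> f[of x u] unfolding piv f'_def by auto
      next
        case 5
        then have piv5: "(x, y) \<in> parcs (pivot G u v) \<longleftrightarrow>
            ((f x \<and> f y) \<noteq> (?A x u \<and> ?A y v)) \<noteq> (?A x v \<and> ?A y u)"
          unfolding piv using f[OF xy] by simp
        from 5 have f'5: "f' z \<longleftrightarrow>
            (if p z = p u then (f z \<noteq> (f u \<and> ?A z v)) \<noteq> (f v \<and> ?A z u) else f z)"
          if "z \<in> {x, y}" for z
          using that by (auto simp: f'_def)
        have far: "?A z u \<longleftrightarrow> f z \<and> f u" "?A z v \<longleftrightarrow> f z \<and> f v" if "p z \<noteq> p u" for z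
          using that True f[of z u] f[of z v] by simp_all
        consider "p x = p u" "p y \<noteq> p u" | "p x \<noteq> p u" "p y = p u" | "p x \<noteq> p u" "p y \<noteq> p u"
          using xy by metis
        then show ?thesis
          unfolding piv5 by cases (auto simp: f'5 far)
      qed
    qed
    then show ?thesis unfolding uniform_partition_def by blast
  next
    case False
    then have fuv: "f u" "f v"
      using f[of u v] uv by auto
    \<comment> \<open>Between the parts of \<open>u\<close> and \<open>v\<close>, one added product
      cancels the old entry \<open>f x \<and> f y\<close>. What remains is the product of adjacency
      to \<open>u\<close> in the first part and adjacency to \<open>v\<close> in the second.\<close>
    define f' where "f' x = (if x = u \<or> x = v then True else
      if p x = p u then ?A x u else if p x = p v then ?A x v else f x)" for x
    have A: "?A x u \<longleftrightarrow> f x" "?A u x \<longleftrightarrow> f x" if "p x \<noteq> p u" for x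
      using that f[of x u] f[of u x] fuv by auto
    have B: "?A x v \<longleftrightarrow> f x" "?A v x \<longleftrightarrow> f x" if "p x \<noteq> p v" for x
      using that f[of x v] f[of v x] fuv by auto
    have "(x, y) \<in> parcs (pivot G u v) \<longleftrightarrow> f' x \<and> f' y" if xy: "p x \<noteq> p y" for x y
    proof -
      consider "x = u" | "x = v" | "x \<noteq> u" "x \<noteq> v" "y = u" | "x \<noteq> u" "x \<noteq> v" "y = v"
        | "x \<noteq> u" "x \<noteq> v" "y \<noteq> u" "y \<noteq> v"
        by blast
      then show ?thesis
      proof cases
        case 1
        then show ?thesis
          using xy uv \<open>u \<noteq> v\<close> B[of y] sym[of v y] sym[of v u] unfolding piv f'_def by auto
      next
        case 2
        then show ?thesis
          using xy uv \<open>u \<noteq> v\<close> A[of y] sym[of u y] unfolding piv f'_def by auto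
      next
        case 3
        then show ?thesis
          using xy uv \<open>u \<noteq> v\<close> B[of x] unfolding piv f'_def by auto
      next
        case 4
        then show ?thesis
          using xy uv \<open>u \<noteq> v\<close> A[of x] unfolding piv f'_def by auto
      next
        case 5
        then have piv5: "(x, y) \<in> parcs (pivot G u v) \<longleftrightarrow>
            ((f x \<and> f y) \<noteq> (?A x u \<and> ?A y v)) \<noteq> (?A x v \<and> ?A y u)"
          unfolding piv using f[OF xy] by simp
        from 5 have f'5: "f' x \<longleftrightarrow> (if p x = p u then ?A x u else if p x = p v then ?A x v else f x)"
          "f' y \<longleftrightarrow> (if p y = p u then ?A y u else if p y = p v then ?A y v else f y)"
          by (simp_all add: f'_def)
        show ?thesis
          unfolding piv5 f'5 using xy \<open>p u \<noteq> p v\<close> A(1)[of x] A(1)[of y] B(1)[of x] B(1)[of y]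
          by (cases "p x = p u"; cases "p x = p v") (auto split: if_splits)
      qed
    qed
    then show ?thesis unfolding uniform_partition_def by blast
  qed
qed

lemma uniform_partition_delete_vertex:
  assumes "uniform_partition G p"
  shows "uniform_partition (delete_vertex G v) p"
proof -
  obtain f where "\<And>x y. p x \<noteq> p y \<Longrightarrow> (x, y) \<in> parcs G \<longleftrightarrow> f x \<and> f y"
    using assms unfolding uniform_partition_def by blast
  then have "\<forall>x y. p x \<noteq> p y \<longrightarrow>
      ((x, y) \<in> parcs (delete_vertex G v) \<longleftrightarrow> (f x \<and> x \<noteq> v) \<and> (f y \<and> y \<noteq> v))"
    by (auto simp: delete_vertex_def)
  then show ?thesis unfolding uniform_partition_def by (rule exI[of _ "\<lambda>x. f x \<and> x \<noteq> v"])
qed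

lemma uniform_partition_pivot_minor:
  assumes "pivot_minor H G" and "pair_graph G" and "uniform_partition G p"
  shows "uniform_partition H p"
  using assms
  by induction
    (simp_all add: pair_graph_pivot_minor uniform_partition_pivot uniform_partition_delete_vertex)

lemma pverts_pivot_minor:
  assumes "pivot_minor H G"
  shows "pverts H \<subseteq> pverts G"
  using assms
  by induction (auto simp: pivot_def local_complement_def delete_vertex_def)

section \<open>Spiders\<close>

text \<open>The claw with subdivided edges: centre \<open>c\<close>, middle vertices
  \<open>a i\<close>, leaves \<open>b i\<close>. The functions matter only at 0, 1, 2. In a
  \<open>pair_graph\<close> the edges make \<open>c\<close> a vertex distinct from every
  \<open>a i\<close>, and \<open>a i\<close> distinct from \<open>b i\<close>.\<close>

definition induced_spider :: "'a pair_pre_digraph \<Rightarrow> 'a \<Rightarrow> (nat \<Rightarrow> 'a) \<Rightarrow> (nat \<Rightarrow> 'a) \<Rightarrow> bool" where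
  "induced_spider G c a b \<longleftrightarrow>
     (\<forall>i<3. a i \<in> pverts G \<and> b i \<in> pverts G \<and> (c, a i) \<in> parcs G \<and> (a i, b i) \<in> parcs G \<and>
        c \<noteq> b i \<and> (c, b i) \<notin> parcs G) \<and>
     (\<forall>i<3. \<forall>j<3. i \<noteq> j \<longrightarrow> a i \<noteq> a j \<and> a i \<noteq> b j \<and> b i \<noteq> b j \<and>
        (a i, a j) \<notin> parcs G \<and> (a i, b j) \<notin> parcs G \<and> (b i, b j) \<notin> parcs G)"

text \<open>
  The only neighbour of \<open>b i\<close> is \<open>a i\<close>, so no edge of the path from \<open>b j\<close> to \<open>b k\<close> can run
  between two parts if \<open>a i\<close> and \<open>b i\<close> are separated.
\<close>

lemma spider_uniform_partition:
  assumes G: "pair_graph G" and S: "induced_spider G c a b" and p: "uniform_partition G p"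
    and ijk: "i < 3" "j < 3" "k < 3" "i \<noteq> j" "j \<noteq> k" "i \<noteq> k" and ne: "p (a i) \<noteq> p (b i)"
  shows "p (b j) = p (b k)"
proof -
  interpret G: pair_graph G by fact
  let ?A = "\<lambda>x y. (x, y) \<in> parcs G"
  have sym: "?A b a" if "?A a b" for a b
    using that G.arcs_symmetric by blast
  obtain f where f: "\<And>x y. p x \<noteq> p y \<Longrightarrow> ?A x y \<longleftrightarrow> f x \<and> f y"
    using p unfolding uniform_partition_def by blast
  have "?A (a i) (b i)"
    using S ijk unfolding induced_spider_def by blast
  then have fb: "f (b i)"
    using f ne by blast
  have nocross: "p x = p y" if "?A x y" "\<not> ?A x (b i)" "\<not> ?A y (b i)" for x y
    using that f[of x y] f[of x "b i"] f[of y "b i"] fb by metis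
  have nadj: "\<not> ?A c (b i)" "\<not> ?A (a j) (b i)" "\<not> ?A (a k) (b i)"
    "\<not> ?A (b j) (b i)" "\<not> ?A (b k) (b i)"
    using S ijk unfolding induced_spider_def by metis+
  have adj: "?A c (a j)" "?A c (a k)" "?A (a j) (b j)" "?A (a k) (b k)"
    using S ijk unfolding induced_spider_def by blast+
  from adj nadj have "p c = p (a j)" "p c = p (a k)" "p (a j) = p (b j)" "p (a k) = p (b k)"
    by (auto intro: nocross)
  then show ?thesis by simp
qed

text \<open>If the leaves lay in three parts, each \<open>a i\<close> would share the part of
  \<open>b i\<close>. The centre misses two of these parts, so its edges to the two middle vertices
  there force \<open>f\<close> on both, and with it an edge between them.\<close>

lemma spider_not_separated:
  assumes G: "pair_graph G" and S: "induced_spider G c a b" and p: "uniform_partition G p"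
  shows "\<not> inj_on (\<lambda>i. p (b i)) {..<3}"
proof
  assume inj: "inj_on (\<lambda>i. p (b i)) {..<3}"
  interpret G: pair_graph G by fact
  obtain f where f: "\<And>x y. p x \<noteq> p y \<Longrightarrow> (x, y) \<in> parcs G \<longleftrightarrow> f x \<and> f y"
    using p unfolding uniform_partition_def by blast
  have ne: "p (b i) \<noteq> p (b j)" if "i < 3" "j < 3" "i \<noteq> j" for i j
    using inj that by (auto simp: inj_on_def)
  have pa: "p (a i) = p (b i)" if i: "i < 3" for i
  proof -
    obtain j k where "j < 3" "k < 3" "i \<noteq> j" "j \<noteq> k" "i \<noteq> (k::nat)"
    proof -
      consider "i = 0" | "i = 1" | "i = 2" using i by linarith
      then show thesis using that[of 1 2] that[of 0 2] that[of 0 1] by cases simp_all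
    qed
    then show ?thesis
      using spider_uniform_partition[OF G S p i] ne by blast
  qed
  obtain i j where ij: "i < 3" "j < 3" "i \<noteq> j" "p c \<noteq> p (a i)" "p c \<noteq> p (a j)"
  proof -
    have "p (a 0) \<noteq> p (a 1)" "p (a 0) \<noteq> p (a 2)" "p (a 1) \<noteq> p (a 2)"
      using pa ne by simp_all
    then consider "p c \<noteq> p (a 0)" "p c \<noteq> p (a 1)" | "p c \<noteq> p (a 0)" "p c \<noteq> p (a 2)"
      | "p c \<noteq> p (a 1)" "p c \<noteq> p (a 2)"
      by metis
    then show thesis using that[of 0 1] that[of 0 2] that[of 1 2] by cases simp_all
  qed
  have "(c, a i) \<in> parcs G" "(c, a j) \<in> parcs G" "(a i, a j) \<notin> parcs G"
    using S ij unfolding induced_spider_def by blast+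
  then show False
    using f[of c "a i"] f[of c "a j"] f[of "a i" "a j"] ij pa[of i] pa[of j] ne[of i j] by simp
qed

text \<open>Both cuts separate \<open>b i\<close> from \<open>b k\<close>, so neither can separate
  \<open>a j\<close> from \<open>b j\<close>. But only \<open>b j\<close> changes sides between the
  two cuts.\<close>

lemma spider_no_linear_cuts:
  assumes G: "pair_graph G" and S: "induced_spider G c a b"
    and ijk: "i < 3" "j < 3" "k < 3" "i \<noteq> j" "j \<noteq> k" "i \<noteq> k"
    and X: "uniform_partition G (\<lambda>x. x \<in> X)" "uniform_partition G (\<lambda>x. x \<in> insert (b j) X)"
    and b: "b i \<in> X" "b j \<notin> X" "b k \<notin> X"
  shows False
proof -
  interpret G: pair_graph G by fact
  have ab: "(a j, b j) \<in> parcs G" and bkj: "b k \<noteq> b j"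
    using S ijk unfolding induced_spider_def by metis+
  have "a j \<noteq> b j"
    using ab G.no_loops' by auto
  have "a j \<notin> X"
    using spider_uniform_partition[OF G S X(1), of j i k] ijk b by blast
  moreover have "a j \<in> insert (b j) X"
    using spider_uniform_partition[OF G S X(2), of j i k] ijk b bkj by blast
  ultimately show False
    using \<open>a j \<noteq> b j\<close> by blast
qed

section \<open>Incomparability graphs of words\<close>

text \<open>Words are coded by \<open>to_nat\<close> so that the vertices are natural numbers, the
  vertex type in the final statement.\<close>

definition incomparability_graph :: "nat list set \<Rightarrow> nat pair_pre_digraph" where
  "incomparability_graph W =
     \<lparr> pverts = to_nat ` W, parcs = {(to_nat v, to_nat w) | v w. v \<in> W \<and> w \<in> W \<and> parallel v w} \<rparr>"

lemma pverts_incomparability_graph [simp]: "pverts (incomparability_graph W) = to_nat ` W"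
  by (simp add: incomparability_graph_def)

lemma parcs_incomparability_graph [simp]:
  "(to_nat v, to_nat w) \<in> parcs (incomparability_graph W) \<longleftrightarrow> v \<in> W \<and> w \<in> W \<and> parallel v w"
  by (auto simp: incomparability_graph_def)

lemma parcs_incomparability_graphE:
  assumes "(x, y) \<in> parcs (incomparability_graph W)"
  obtains v w where "x = to_nat v" "y = to_nat w" "v \<in> W" "w \<in> W" "parallel v w"
  using assms by (auto simp: incomparability_graph_def)

lemma pair_graph_incomparability_graph:
  assumes "finite W"
  shows "pair_graph (incomparability_graph W)"
proof -
  let ?G = "incomparability_graph W"
  have sub: "parcs ?G \<subseteq> pverts ?G \<times> pverts ?G"
    by (auto elim: parcs_incomparability_graphE)
  show ?thesis
  proof
    show "finite (pverts ?G)" using assms by simp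
    show "finite (parcs ?G)"
      using sub by (rule finite_subset) (use assms in simp)
    show "symmetric (with_proj ?G)"
      by (auto simp: symmetric_def parallel_def intro!: symI elim!: parcs_incomparability_graphE)
    show "fst e \<in> pverts ?G" "snd e \<in> pverts ?G" if "e \<in> parcs ?G" for e
      using that sub by auto
    show "fst e \<noteq> snd e" if "e \<in> parcs ?G" for e
      using that by (cases e) (auto simp: parallel_def elim!: parcs_incomparability_graphE)
  qed
qed

text \<open>Reduces uniformity to words. The witness holds only at codes of words in
  \<open>W\<close>, since uniformity also speaks about numbers that are not vertices.\<close>

lemma incomparability_uniform_partition:
  fixes g :: "nat list \<Rightarrow> bool"
  assumes "\<And>v w. p (to_nat v) \<noteq> p (to_nat w) \<Longrightarrow> parallel v w \<longleftrightarrow> g v \<and> g w"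
  shows "uniform_partition (incomparability_graph W) p"
proof -
  have "(x, y) \<in> parcs (incomparability_graph W) \<longleftrightarrow>
      (\<exists>v\<in>W. x = to_nat v \<and> g v) \<and> (\<exists>w\<in>W. y = to_nat w \<and> g w)" if "p x \<noteq> p y" for x y
    using that assms by (fastforce elim!: parcs_incomparability_graphE)
  then show ?thesis
    unfolding uniform_partition_def by (intro exI[of _ "\<lambda>x. \<exists>v\<in>W. x = to_nat v \<and> g v"]) simp
qed

text \<open>The label of the component of \<open>v\<close> once \<open>w\<close> is taken as a cut
  point: \<open>Suc l\<close> below the child \<open>w @ [l]\<close>, and 0 for \<open>w\<close>
  itself and everything not below it. The successor keeps child 0 apart from the rest.\<close>

definition branch :: "nat list \<Rightarrow> nat list \<Rightarrow> nat" where
  "branch w v = (if strict_prefix w v then Suc (v ! length w) else 0)"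

lemma branch_eq_Suc_iff: "branch w v = Suc l \<longleftrightarrow> prefix (w @ [l]) v"
  by (auto simp: branch_def strict_prefix_def prefix_def nth_append neq_Nil_conv)

lemma branch_eq_0_iff: "branch w v = 0 \<longleftrightarrow> \<not> strict_prefix w v"
  by (simp add: branch_def)

text \<open>Words below different children of \<open>w\<close> are always incomparable. A word
  strictly below \<open>w\<close> is comparable to one that is not exactly when the latter is a
  prefix of \<open>w\<close>.\<close>

lemma parallel_iff_branch_neq:
  assumes "branch w v \<noteq> branch w u"
  shows "parallel v u \<longleftrightarrow> \<not> prefix v w \<and> \<not> prefix u w"
proof -
  have *: "parallel v u \<longleftrightarrow> \<not> prefix u w" if "strict_prefix w v" "\<not> strict_prefix w u" for v u
    using that unfolding parallel_def strict_prefix_def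
    by (metis prefix_order.trans prefix_order.antisym prefix_same_cases)
  have sym: "parallel v u \<longleftrightarrow> parallel u v"
    by (auto simp: parallel_def)
  have np: "\<not> prefix v w" if "strict_prefix w v" for v
    using that unfolding strict_prefix_def by (metis prefix_order.antisym)
  consider "strict_prefix w v" "strict_prefix w u" | "strict_prefix w v" "\<not> strict_prefix w u"
    | "\<not> strict_prefix w v" "strict_prefix w u"
    using assms by (cases "strict_prefix w v"; cases "strict_prefix w u") (auto simp: branch_def)
  then show ?thesis
  proof cases
    case 1
    then obtain v' u' where vu: "v = w @ v'" "u = w @ u'" "v' \<noteq> []" "u' \<noteq> []"
      unfolding strict_prefix_def prefix_def by auto
    moreover have "hd v' \<noteq> hd u'"
      using assms 1 vu by (simp add: branch_def nth_append hd_conv_nth)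
    ultimately have "parallel v u"
      by (cases v'; cases u') (auto simp: parallel_def)
    then show ?thesis using 1 np by blast
  next
    case 2
    then show ?thesis using * np by blast
  next
    case 3
    then show ?thesis using * np sym by blast
  qed
qed

lemma uniform_partition_branch:
  "uniform_partition (incomparability_graph W) (\<lambda>x. branch w (from_nat x))"
  by (rule incomparability_uniform_partition[where g = "\<lambda>v. \<not> prefix v w"])
    (simp add: parallel_iff_branch_neq)

lemma uniform_partition_below:
  fixes w :: "nat list"
  shows "uniform_partition (incomparability_graph W) (\<lambda>x. x \<in> to_nat ` {v. strict_prefix w v})"
proof (rule incomparability_uniform_partition[where g = "\<lambda>v. \<not> prefix v w"])
  fix v u :: "nat list"
  let ?X = "to_nat ` {v. strict_prefix w v}"
  assume "(to_nat v \<in> ?X) \<noteq> (to_nat u \<in> ?X)"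
  then have "branch w v \<noteq> branch w u"
    by (auto simp: branch_def inj_image_mem_iff)
  then show "parallel v u \<longleftrightarrow> \<not> prefix v w \<and> \<not> prefix u w"
    by (rule parallel_iff_branch_neq)
qed

text \<open>Moving \<open>w\<close> itself to the lower side requires a new flag, now true at
  \<open>w\<close>. Together with the previous cut this gives two cuts differing in one vertex, as
  \<open>spider_no_linear_cuts\<close> demands.\<close>

lemma uniform_partition_below_eq:
  fixes w :: "nat list"
  shows "uniform_partition (incomparability_graph W)
     (\<lambda>x. x \<in> insert (to_nat w) (to_nat ` {v. strict_prefix w v}))"
proof (rule incomparability_uniform_partition[where g = "\<lambda>v. prefix w v \<or> \<not> prefix v w"])
  fix v u :: "nat list"
  let ?X = "insert (to_nat w) (to_nat ` {v. strict_prefix w v})"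
  have X: "to_nat v \<in> ?X \<longleftrightarrow> prefix w v" for v :: "nat list"
    by (auto simp: strict_prefix_def inj_image_mem_iff)
  have *: "parallel v u \<longleftrightarrow> \<not> prefix u w" if "prefix w v" "\<not> prefix w u" for v u :: "nat list"
    using that unfolding parallel_def by (metis prefix_order.trans prefix_same_cases)
  assume "(to_nat v \<in> ?X) \<noteq> (to_nat u \<in> ?X)"
  then have "prefix w v \<noteq> prefix w u"
    unfolding X .
  then show "parallel v u \<longleftrightarrow> (prefix w v \<or> \<not> prefix v w) \<and> (prefix w u \<or> \<not> prefix u w)"
    using *[of v u] *[of u v] unfolding parallel_def by blast
qed

text \<open>
  The longest word \<open>w\<close> lying below two of the three leaves of a spider either separates all
  three leaves, or is itself a leaf and lies between the other two.
\<close>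

lemma incomparability_graph_no_spider:
  assumes W: "finite W" and H: "pivot_minor H (incomparability_graph W)"
  shows "\<not> induced_spider H c a b"
proof
  assume S: "induced_spider H c a b"
  let ?G = "incomparability_graph W"
  have G: "pair_graph ?G" using W by (rule pair_graph_incomparability_graph)
  have pgH: "pair_graph H" using H G by (rule pair_graph_pivot_minor)
  note up = uniform_partition_pivot_minor[OF H G]
  define y where "y i = (from_nat (b i) :: nat list)" for i
  have b: "b i = to_nat (y i)" if "i < 3" for i
    using S pverts_pivot_minor[OF H] that unfolding induced_spider_def y_def by force
  have y_ne: "y i \<noteq> y j" if "i < 3" "j < 3" "i \<noteq> j" for i j
    using S that b unfolding induced_spider_def by metis
  let ?P = "\<lambda>w. \<exists>i j. i < 3 \<and> j < 3 \<and> i \<noteq> j \<and> prefix w (y i) \<and> prefix w (y j)"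
  have "?P []"
    by (intro exI[of _ 0] exI[of _ 1]) simp
  moreover have "length w < Suc (length (y 0) + length (y 1) + length (y 2))" if w: "?P w" for w
  proof -
    obtain i where i: "i < 3" "prefix w (y i)" using w by blast
    then have "i = 0 \<or> i = 1 \<or> i = 2" by linarith
    then show ?thesis using prefix_length_le[OF i(2)] by auto
  qed
  ultimately have "\<exists>w. ?P w \<and> (\<forall>w'. ?P w' \<longrightarrow> length w' \<le> length w)"
    by (intro ex_has_greatest_nat[of ?P "[]" length
          "Suc (length (y 0) + length (y 1) + length (y 2))"]) blast+
  then obtain w where w: "?P w" and w_max: "\<And>w'. ?P w' \<Longrightarrow> length w' \<le> length w"
    by blast
  obtain i j where ij: "i < 3" "j < 3" "i \<noteq> j" "prefix w (y i)" "prefix w (y j)"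
    using w by blast
  \<comment> \<open>The configuration of a leaf between two others: \<open>y l\<close> is
    \<open>w\<close>, \<open>y k\<close> lies strictly below it, and \<open>y m\<close> does
    not.\<close>
  have key: False if klm: "k < 3" "l < 3" "m < 3" "k \<noteq> l" "l \<noteq> m" "k \<noteq> m"
    and *: "prefix w (y k)" "prefix w (y l)" "\<not> strict_prefix w (y l)" "\<not> strict_prefix w (y m)"
    for k l m
  proof -
    have yl: "y l = w"
      using * by (simp add: strict_prefix_def)
    then have "strict_prefix w (y k)"
      using *(1) y_ne klm by (auto simp: strict_prefix_def)
    then show False
      using spider_no_linear_cuts[OF pgH S klm up[OF uniform_partition_below[of W w]]]
        up[OF uniform_partition_below_eq[of W w]] b klm *(3,4) yl
      by (simp add: inj_image_mem_iff)
  qed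
  have "\<not> inj_on (\<lambda>i. branch w (y i)) {..<3}"
    using spider_not_separated[OF pgH S up[OF uniform_partition_branch[of W w]]]
    by (simp add: y_def)
  then obtain k l where kl: "k < 3" "l < 3" "k \<noteq> l" "branch w (y k) = branch w (y l)"
    unfolding inj_on_def by auto
  \<comment> \<open>A nonzero common branch would make \<open>w @ [n]\<close> a longer common prefix
    of two leaves.\<close>
  have "branch w (y k) = 0"
  proof (cases "branch w (y k)")
    case (Suc n)
    then have "?P (w @ [n])"
      using kl branch_eq_Suc_iff by metis
    then show ?thesis using w_max by fastforce
  qed simp
  then have ns: "\<not> strict_prefix w (y k)" "\<not> strict_prefix w (y l)"
    using kl(4) unfolding branch_eq_0_iff[symmetric] by simp_all
  have eq: "y n = w" if "prefix w (y n)" "\<not> strict_prefix w (y n)" for n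
    using that by (simp add: strict_prefix_def)
  \<comment> \<open>Two pairs out of three indices meet. They cannot coincide, since then
    \<open>y i\<close> and \<open>y j\<close> would both be \<open>w\<close>. So exactly one index
    is shared; its leaf is \<open>w\<close>, and it serves as the middle leaf in
    \<open>key\<close>.\<close>
  have "i = k \<or> i = l \<or> j = k \<or> j = l"
    using ij(1-3) kl(1-3) by linarith
  moreover have "\<not> (i \<in> {k, l} \<and> j \<in> {k, l})"
    using eq[of i] eq[of j] ij ns y_ne[of i j] by auto
  ultimately show False
    using key[of j i l] key[of j i k] key[of i j l] key[of i j k] ij kl ns by auto
qed

section \<open>Connectedness, short distances and distance-heredity\<close>

lemma connected_crossing_arc:
  assumes K: "Digraph_Component.connected (with_proj K)" and sym: "sym (parcs K)"
    and v: "v \<in> pverts K" "v \<in> D" and w: "w \<in> pverts K" "w \<notin> D"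
  obtains x y where "(x, y) \<in> parcs K" "x \<in> D" "y \<notin> D"
proof -
  have "(v, w) \<in> rtrancl_on (pverts K) ((parcs K)\<^sup>s)"
    using K v w by (simp add: connected_conv)
  then have "w \<in> D \<or> (\<exists>x y. (x, y) \<in> parcs K \<and> x \<in> D \<and> y \<notin> D)"
  proof (induction rule: rtrancl_on_induct)
    case base
    then show ?case using v by simp
  next
    case (step y z)
    have "(y, z) \<in> parcs K"
      using step.hyps(2) sym by (auto simp: symcl_def dest: symD)
    then show ?case using step.IH by blast
  qed
  then show thesis using w that by blast
qed

text \<open>The distance is an infimum of walk costs, so each value needs a walk and a lower bound
  on all walks. Values up to two suffice for the incomparability graphs.\<close>

lemma distance_small:
  assumes K: "wf_digraph (with_proj K)" and v: "v \<in> pverts K"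
  shows "distance K v v = 0"
    and "v \<noteq> w \<Longrightarrow> (v, w) \<in> parcs K \<Longrightarrow> distance K v w = 1"
    and "v \<noteq> w \<Longrightarrow> (v, w) \<notin> parcs K \<Longrightarrow> (v, u) \<in> parcs K \<Longrightarrow> (u, w) \<in> parcs K \<Longrightarrow>
      distance K v w = 2"
proof -
  interpret K: wf_digraph "with_proj K" by fact
  have cost: "K.awalk_cost (\<lambda>_. 1) p = real (length p)" for p :: "('a \<times> 'a) list"
    by (induction p) simp_all
  have le: "distance K v w \<le> real (length p)" if "K.awalk v p w" for w p
    using K.min_cost_le_walk_cost[OF that, of "\<lambda>_. 1"] by (simp add: distance_def cost)
  have ge: "real n \<le> distance K v w" if "\<And>p. K.awalk v p w \<Longrightarrow> n \<le> length p" for w n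
    unfolding distance_def K.\<mu>_def using that by (auto intro!: INF_greatest simp: cost)
  show "distance K v v = 0"
    using le[of "[]" v] ge[of v 0] v by (simp add: K.awalk_Nil_iff zero_ereal_def)
  have verts: "x \<in> pverts K" "y \<in> pverts K" if "(x, y) \<in> parcs K" for x y
    using K.tail_in_verts[of "(x, y)"] K.head_in_verts[of "(x, y)"] that by auto
  show "distance K v w = 1" if "v \<noteq> w" "(v, w) \<in> parcs K"
  proof (rule antisym)
    show "distance K v w \<le> 1"
      using le[of "[(v, w)]" w] that verts
      by (simp add: K.awalk_Cons_iff K.awalk_Nil_iff one_ereal_def)
    have "1 \<le> length p" if "K.awalk v p w" for p
      using that \<open>v \<noteq> w\<close> by (cases p) (auto simp: K.awalk_Nil_iff)
    then show "1 \<le> distance K v w"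
      using ge[of w 1] by (simp add: one_ereal_def)
  qed
  show "distance K v w = 2" if "v \<noteq> w" "(v, w) \<notin> parcs K" "(v, u) \<in> parcs K" "(u, w) \<in> parcs K"
  proof (rule antisym)
    show "distance K v w \<le> 2"
      using le[of "[(v, u), (u, w)]" w] that verts
      by (simp add: K.awalk_Cons_iff K.awalk_Nil_iff)
    have "2 \<le> length p" if p: "K.awalk v p w" for p
    proof (cases p)
      case Nil
      then show ?thesis using p \<open>v \<noteq> w\<close> by (simp add: K.awalk_Nil_iff)
    next
      case (Cons e q)
      then show ?thesis
        using p \<open>(v, w) \<notin> parcs K\<close> by (cases q) (auto simp: K.awalk_Nil_iff K.awalk_Cons_iff)
    qed
    then show "2 \<le> distance K v w"
      using ge[of w 2] by simp
  qed
qed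

text \<open>
  If \<open>v\<close> is a prefix of \<open>w\<close>, then every neighbour of \<open>v\<close> is also one of \<open>w\<close>; so in a connected
  induced subgraph two non-adjacent vertices have distance two.
\<close>

lemma distance_hereditary_incomparability_graph:
  assumes W: "finite W"
  shows "distance_hereditary (incomparability_graph W)"
  unfolding distance_hereditary_def
proof (intro allI impI ballI, elim conjE)
  fix H :: "nat pair_pre_digraph" and x y
  let ?G = "incomparability_graph W"
  assume ind: "induced_subgraph (with_proj H) (with_proj ?G)"
    and conn: "Digraph_Component.connected (with_proj H)" and xy: "x \<in> pverts H" "y \<in> pverts H"
  interpret G: pair_graph ?G using W by (rule pair_graph_incomparability_graph)
  have wfG: "wf_digraph (with_proj ?G)" and wfH: "wf_digraph (with_proj H)"
    and vH: "pverts H \<subseteq> to_nat ` W"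
    using ind unfolding induced_subgraph_def subgraph_def by auto
  have aH: "(a, b) \<in> parcs H \<longleftrightarrow> (a, b) \<in> parcs ?G \<and> a \<in> pverts H \<and> b \<in> pverts H" for a b
    using ind unfolding induced_subgraph_def by auto
  have symG: "(b, a) \<in> parcs ?G" if "(a, b) \<in> parcs ?G" for a b
    using that by (rule G.arcs_symmetric)
  have symH: "sym (parcs H)"
    using symG by (auto intro!: symI simp: aH)
  have nbr: "\<exists>u. (v, u) \<in> parcs H" if v: "v \<in> pverts H" "w \<in> pverts H" "v \<noteq> w" for v w
    using connected_crossing_arc[OF conn symH v(1) _ v(2), of "{v}"] v(3) by blast
  have common: "\<exists>u. (to_nat v, u) \<in> parcs H \<and> (u, to_nat w) \<in> parcs H"
    if vw: "to_nat v \<in> pverts H" "to_nat w \<in> pverts H" "v \<noteq> w" "prefix v w" for v w :: "nat list"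
  proof -
    obtain x where x: "(to_nat v, x) \<in> parcs H"
      using nbr[OF vw(1,2)] vw(3) by auto
    then obtain u where u: "x = to_nat u" "u \<in> W" "parallel v u"
      unfolding aH by (auto elim!: parcs_incomparability_graphE)
    have "parallel u w"
      using u(3) vw(4) unfolding parallel_def by (metis prefix_order.trans prefix_same_cases)
    moreover have "w \<in> W"
      using vw(2) vH by auto
    ultimately have "(x, to_nat w) \<in> parcs ?G"
      using u by simp
    then have "(x, to_nat w) \<in> parcs H"
      using x vw by (simp add: aH)
    then show ?thesis using x by blast
  qed
  show "distance H x y = distance ?G x y"
  proof (cases "x = y \<or> (x, y) \<in> parcs ?G")
    case True
    then show ?thesis
      using distance_small(1,2)[OF wfH xy(1)] distance_small(1,2)[OF wfG] xy vH aH
      by (metis pverts_incomparability_graph subsetD)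
  next
    case False
    obtain v w where vw: "x = to_nat v" "y = to_nat w" "v \<in> W" "w \<in> W"
      using xy vH by blast
    then have "prefix v w \<or> prefix w v" "v \<noteq> w"
      using False by (auto simp: parallel_def)
    then obtain u where "(x, u) \<in> parcs H" "(u, y) \<in> parcs H"
      using common[of v w] common[of w v] xy symH unfolding vw by (metis symD)
    then show ?thesis
      using False distance_small(3)[OF wfH xy(1), of y u] distance_small(3)[OF wfG, of x y u]
        xy vH aH
      by (metis pverts_incomparability_graph subsetD)
  qed
qed

section \<open>Spiders in trees\<close>

lemma vpath_with_proj_iff:
  "vpath p (with_proj G) \<longleftrightarrow>
     p \<noteq> [] \<and> set p \<subseteq> pverts G \<and> successively (\<lambda>x y. (x, y) \<in> parcs G) p \<and> distinct p"
proof -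
  have "set (vwalk_arcs p) \<subseteq> parcs G \<longleftrightarrow> successively (\<lambda>x y. (x, y) \<in> parcs G) p"
    by (induction p rule: vwalk_arcs.induct) auto
  then show ?thesis
    by (auto simp: vpath_def vwalk_def)
qed

text \<open>A chord would close the subpath between its ends to a cycle. Five vertices are the
  length of a leaf-to-leaf path of a spider; three such paths cover all pairs of its
  vertices.\<close>

lemma tree_path_chordless:
  assumes T: "is_tree T" and p: "vpath [v, w, x, y, z] (with_proj T)"
  shows "(v, x) \<notin> parcs T" "(v, y) \<notin> parcs T" "(v, z) \<notin> parcs T"
    "(w, y) \<notin> parcs T" "(w, z) \<notin> parcs T" "(x, z) \<notin> parcs T"
proof -
  interpret T: pair_graph T
    using T by (simp add: is_tree_def)
  have nc: "(hd q, last q) \<notin> parcs T" if "vpath q (with_proj T)" "length q \<ge> 3" for q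
    using T that T.arcs_symmetric unfolding is_tree_def is_cycle_def by blast
  show "(v, x) \<notin> parcs T" "(v, y) \<notin> parcs T" "(v, z) \<notin> parcs T"
    "(w, y) \<notin> parcs T" "(w, z) \<notin> parcs T" "(x, z) \<notin> parcs T"
    using p nc[of "[v, w, x]"] nc[of "[v, w, x, y]"] nc[of "[v, w, x, y, z]"]
      nc[of "[w, x, y]"] nc[of "[w, x, y, z]"] nc[of "[x, y, z]"]
    by (simp_all add: vpath_with_proj_iff)
qed

lemma ex_longest_vpath:
  assumes G: "pair_graph G" and v: "v \<in> pverts G"
  obtains p where "vpath p (with_proj G)"
    "\<And>q. vpath q (with_proj G) \<Longrightarrow> length q \<le> length p"
proof -
  interpret G: pair_graph G by fact
  have "vpath [v] (with_proj G)"
    using v by (simp add: vpath_with_proj_iff)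
  moreover have "length p < Suc (card (pverts G))" if "vpath p (with_proj G)" for p
    using that card_mono[OF G.pair_finite_verts, of "set p"]
    by (simp add: vpath_with_proj_iff distinct_card)
  ultimately have "\<exists>p. vpath p (with_proj G) \<and>
      (\<forall>q. vpath q (with_proj G) \<longrightarrow> length q \<le> length p)"
    by (intro ex_has_greatest_nat[where b = "Suc (card (pverts G))"]) auto
  then show thesis using that by blast
qed

text \<open>
  A vertex at distance two from a longest path is attached to it through a path vertex with
  at least two further path vertices on either side, which is the centre of the spider.
\<close>

lemma non_caterpillar_has_spider:
  assumes T: "is_tree T" and nc: "\<not> is_caterpillar T"
  shows "\<exists>c a b. induced_spider T c a b"
proof -
  interpret T: pair_graph T
    using T by (simp add: is_tree_def)
  have conn: "Digraph_Component.connected (with_proj T)"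
    using T by (simp add: is_tree_def)
  let ?A = "\<lambda>x y. (x, y) \<in> parcs T"
  have sym: "?A y x" if "?A x y" for x y
    using that by (rule T.arcs_symmetric)
  have symT: "sym (parcs T)"
    using sym by (auto intro: symI)
  obtain v0 where "v0 \<in> pverts T"
    using conn by (auto simp: connected_conv)
  then obtain p where p: "vpath p (with_proj T)"
    and longest: "\<And>q. vpath q (with_proj T) \<Longrightarrow> length q \<le> length p"
    using ex_longest_vpath[OF T.pair_graph_axioms] by metis
  \<comment> \<open>The vertices on \<open>p\<close> or adjacent to it. An edge leaving
    \<open>D\<close> ends in a vertex \<open>w\<close> two steps from \<open>p\<close>, reached
    through some \<open>x\<close> off \<open>p\<close>.\<close>
  define D where "D = set p \<union> {x. \<exists>y\<in>set p. ?A x y}"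
  obtain v where v: "v \<in> pverts T" "v \<notin> D"
    using nc T p unfolding is_caterpillar_def D_def by blast
  have "hd p \<in> pverts T" "hd p \<in> D"
    using p by (auto simp: vpath_with_proj_iff D_def)
  then obtain x w where xw: "?A x w" "x \<in> D" "w \<notin> D"
    using connected_crossing_arc[OF conn symT _ _ v] by metis
  then have "x \<notin> set p" "w \<notin> set p"
    using sym by (auto simp: D_def)
  then obtain c where c: "c \<in> set p" "?A x c"
    using xw by (auto simp: D_def)
  then obtain p1 p2 where p12: "p = p1 @ c # p2"
    by (auto simp: in_set_conv_decomp)
  have wx: "w \<noteq> x" "w \<in> pverts T" "x \<in> pverts T"
    using xw T.no_loops' T.in_arcsD1 T.in_arcsD2 by auto
  \<comment> \<open>Replacing either end of \<open>p\<close> beyond \<open>c\<close> by the detour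
    \<open>x\<close>, \<open>w\<close> gives a path; as \<open>p\<close> is longest, each replaced
    end has at least two vertices.\<close>
  have paths: "vpath (p1 @ [c, x, w]) (with_proj T)" "vpath (w # x # c # p2) (with_proj T)"
    using p c(2) xw(1) sym wx \<open>x \<notin> set p\<close> \<open>w \<notin> set p\<close>
    by (auto simp: vpath_with_proj_iff p12 successively_append_iff successively_Cons)
  have "length p2 \<ge> 2" "length p1 \<ge> 2"
    using longest[OF paths(1)] longest[OF paths(2)] by (simp_all add: p12)
  then obtain a0 b0 p1' a1 b1 p2' where p12': "p1 = p1' @ [b0, a0]" "p2 = a1 # b1 # p2'"
    by (cases p2; cases "tl p2"; cases p1 rule: rev_cases; cases "butlast p1" rule: rev_cases) auto
  have path01: "vpath [b0, a0, c, a1, b1] (with_proj T)"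
    using p by (auto simp: vpath_with_proj_iff p12 p12' successively_append_iff successively_Cons)
  have path02: "vpath [b0, a0, c, x, w] (with_proj T)"
    and path12: "vpath [b1, a1, c, x, w] (with_proj T)"
    using path01 p c(2) xw(1) sym wx \<open>x \<notin> set p\<close> \<open>w \<notin> set p\<close>
    by (auto simp: vpath_with_proj_iff p12 p12')
  define a where "a = (\<lambda>i::nat. [a0, a1, x] ! i)"
  define b where "b = (\<lambda>i::nat. [b0, b1, w] ! i)"
  have lt3: "(\<forall>i<3. P i) \<longleftrightarrow> P 0 \<and> P 1 \<and> P (2::nat)" for P
    by (auto simp: numeral_3_eq_3 less_Suc_eq numeral_2_eq_2)
  have ab: "a 0 = a0" "a 1 = a1" "a 2 = x" "b 0 = b0" "b 1 = b1" "b 2 = w"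
    by (simp_all add: a_def b_def)
  note chords = tree_path_chordless[OF T path01] tree_path_chordless[OF T path02]
    tree_path_chordless[OF T path12]
  have "induced_spider T c a b"
    using path01 path02 path12 chords sym
    unfolding induced_spider_def lt3 ab by (auto simp: vpath_with_proj_iff)
  then show ?thesis by blast
qed

section \<open>Transfer of spiders along isomorphisms\<close>

text \<open>The library isomorphism also maps arcs, tails and heads. Since both digraphs come from
  \<open>with_proj\<close>, tail and head are \<open>fst\<close> and \<open>snd\<close>, so the
  vertex map determines the arc map. Its inverse is returned because spiders are carried from
  \<open>T\<close> to \<open>H\<close>.\<close>

lemma digraph_iso_bij:
  assumes "digraph_iso (with_proj H) (with_proj T)"
  obtains \<phi> where "bij_betw \<phi> (pverts T) (pverts H)"
    "\<And>x y. x \<in> pverts T \<Longrightarrow> y \<in> pverts T \<Longrightarrow> (\<phi> x, \<phi> y) \<in> parcs H \<longleftrightarrow> (x, y) \<in> parcs T"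
proof -
  obtain h where h: "pre_digraph.digraph_isomorphism (with_proj H) h"
    and T: "with_proj T = app_iso h (with_proj H)"
    using assms unfolding digraph_iso_def by blast
  let ?f = "iso_verts h"
  have inj: "inj_on ?f (pverts H)" and wf: "wf_digraph (with_proj H)"
    and ends: "\<And>a. a \<in> parcs H \<Longrightarrow>
      ?f (fst a) = iso_tail h (iso_arcs h a) \<and> ?f (snd a) = iso_head h (iso_arcs h a)"
    using h unfolding pre_digraph.digraph_isomorphism_def by auto
  have vT: "pverts T = ?f ` pverts H" and aT: "parcs T = iso_arcs h ` parcs H"
    and th: "iso_tail h = fst" "iso_head h = snd"
    using T unfolding app_iso_def with_proj_def by auto
  have aT': "parcs T = map_prod ?f ?f ` parcs H"
    unfolding aT
  proof (rule image_cong)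
    show "iso_arcs h e = map_prod ?f ?f e" if "e \<in> parcs H" for e
      using ends[OF that] by (simp add: th prod_eq_iff)
  qed simp
  have vH: "x \<in> pverts H" "y \<in> pverts H" if "(x, y) \<in> parcs H" for x y
    using wf_digraph.tail_in_verts[OF wf, of "(x, y)"] that
      wf_digraph.head_in_verts[OF wf, of "(x, y)"] by auto
  have arc: "(x, y) \<in> parcs H \<longleftrightarrow> (?f x, ?f y) \<in> parcs T" if xy: "x \<in> pverts H" "y \<in> pverts H" for x y
  proof
    assume "(?f x, ?f y) \<in> parcs T"
    then obtain x' y' where "(x', y') \<in> parcs H" "?f x' = ?f x" "?f y' = ?f y"
      unfolding aT' by auto
    then show "(x, y) \<in> parcs H"
      using inj_onD[OF inj] vH xy by metis
  qed (force simp: aT')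
  let ?g = "inv_into (pverts H) ?f"
  have bij: "bij_betw ?f (pverts H) (pverts T)"
    using inj by (simp add: bij_betw_def vT)
  show thesis
  proof
    show "bij_betw ?g (pverts T) (pverts H)"
      using bij by (rule bij_betw_inv_into)
    show "(?g x, ?g y) \<in> parcs H \<longleftrightarrow> (x, y) \<in> parcs T" if "x \<in> pverts T" "y \<in> pverts T" for x y
      using arc[of "?g x" "?g y"] that
      by (simp add: vT inv_into_into f_inv_into_f)
  qed
qed

lemma induced_spider_iso:
  assumes "digraph_iso (with_proj H) (with_proj T)" and T: "pair_graph T"
    and S: "induced_spider T c a b"
  shows "\<exists>c a b. induced_spider H c a b"
proof -
  interpret T: pair_graph T by fact
  obtain \<phi> where \<phi>: "bij_betw \<phi> (pverts T) (pverts H)"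
    and arc: "\<And>x y. x \<in> pverts T \<Longrightarrow> y \<in> pverts T \<Longrightarrow> (\<phi> x, \<phi> y) \<in> parcs H \<longleftrightarrow> (x, y) \<in> parcs T"
    using digraph_iso_bij[OF assms(1)] by blast
  have c: "c \<in> pverts T"
    using S T.in_arcsD1 unfolding induced_spider_def by (metis zero_less_numeral)
  have ab: "a i \<in> pverts T" "b i \<in> pverts T" if "i < 3" for i
    using S that unfolding induced_spider_def by blast+
  have eq: "\<phi> x = \<phi> y \<longleftrightarrow> x = y" if "x \<in> pverts T" "y \<in> pverts T" for x y
    using \<phi> that by (auto simp: bij_betw_def inj_on_def)
  have mem: "\<phi> x \<in> pverts H" if "x \<in> pverts T" for x
    using \<phi> that by (auto simp: bij_betw_def)
  have "induced_spider H (\<phi> c) (\<phi> \<circ> a) (\<phi> \<circ> b)"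
    using S c ab unfolding induced_spider_def by (simp add: eq mem arc)
  then show ?thesis by blast
qed

section \<open>Linear rank-width of complete ternary trees\<close>

text \<open>Over the binary field every linear combination of a basis is a subset sum, so a basis of
  size \<open>r\<close> spans at most \<open>2 ^ r\<close> rows.\<close>

lemma card_rows_le_two_power_rank:
  fixes M :: "'r \<Rightarrow> 'c \<Rightarrow> bit"
  assumes "finite R"
  shows "card ((\<lambda>r c. if c \<in> C then M r c else 0) ` R) \<le> 2 ^ submatrix_rank R C M"
proof -
  interpret V: vector_space "\<lambda>(c :: bit) (f :: 'c \<Rightarrow> bit) x. c * f x"
    by (rule vector_space_fun)
  let ?rows = "(\<lambda>r c. if c \<in> C then M r c else 0) ` R"
  obtain B where B: "B \<subseteq> ?rows" "?rows \<subseteq> V.span B" "card B = V.dim ?rows"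
    by (rule V.basis_exists)
  have fin: "finite B"
    using B(1) assms by (meson finite_imageI finite_subset)
  have "V.span B \<subseteq> (\<lambda>T. \<Sum>T) ` Pow B"
  proof
    fix f assume "f \<in> V.span B"
    then obtain u where f: "f = (\<Sum>v\<in>B. (\<lambda>x. u v * v x))"
      using V.span_finite[OF fin] by auto
    have "(\<Sum>v\<in>B. (\<lambda>x. u v * v x)) = (\<Sum>v\<in>{v\<in>B. u v = 1}. v)"
      unfolding sum.inter_filter[OF fin] by (intro sum.cong) (auto simp: zero_fun_def)
    then show "f \<in> (\<lambda>T. \<Sum>T) ` Pow B"
      unfolding f by auto
  qed
  then have "card ?rows \<le> card ((\<lambda>T. \<Sum>T) ` Pow B)"
    using B(2) fin by (intro card_mono) auto
  also have "\<dots> \<le> card (Pow B)"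
    using fin by (intro card_image_le) simp
  also have "\<dots> = 2 ^ submatrix_rank R C M"
    using fin B(3) by (simp add: card_Pow submatrix_rank_def)
  finally show ?thesis .
qed

text \<open>A neighbourhood across the cut is the support of a row, so distinct neighbourhoods come
  from distinct rows.\<close>

lemma card_neighbourhoods_le_two_power_cutrk:
  assumes "finite X"
  shows "card ((\<lambda>x. {y \<in> pverts G - X. (x, y) \<in> parcs G}) ` X) \<le> 2 ^ cutrk G X"
proof -
  let ?row = "\<lambda>x y. if y \<in> pverts G - X then adj_matrix G x y else 0"
  have "(\<lambda>x. {y \<in> pverts G - X. (x, y) \<in> parcs G}) ` X = (\<lambda>f. {y. f y = 1}) ` ?row ` X"
    unfolding image_image by (intro image_cong) (auto simp: adj_matrix_def)
  also have "card \<dots> \<le> card (?row ` X)"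
    using assms by (intro card_image_le) simp
  also have "\<dots> \<le> 2 ^ cutrk G X"
    unfolding cutrk_def by (rule card_rows_le_two_power_rank[OF assms])
  finally show ?thesis .
qed

section \<open>Counting distinct rows in complete ternary trees\<close>

definition full_tree :: "nat \<Rightarrow> nat list \<Rightarrow> nat list set" where
  "full_tree h w = (@) w ` {u. set u \<subseteq> {..<3} \<and> length u \<le> h}"

lemma finite_full_tree: "finite (full_tree h w)"
  unfolding full_tree_def by (intro finite_imageI finite_lists_length_le) simp

lemma full_tree_root: "w \<in> full_tree h w"
  unfolding full_tree_def by (rule image_eqI[of _ _ "[]"]) simp_all

lemma full_tree_child_subset:
  assumes "i < 3"
  shows "full_tree h (w @ [i]) \<subseteq> full_tree (Suc h) w"
proof
  fix v assume "v \<in> full_tree h (w @ [i])"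
  then obtain u where "v = w @ (i # u)" "set u \<subseteq> {..<3}" "length u \<le> h"
    by (auto simp: full_tree_def)
  then show "v \<in> full_tree (Suc h) w"
    using assms unfolding full_tree_def by (intro image_eqI[of _ _ "i # u"]) simp_all
qed

lemma prefix_full_tree: "v \<in> full_tree h w \<Longrightarrow> prefix w v"
  by (auto simp: full_tree_def)

lemma parallel_full_tree_children:
  assumes "v \<in> full_tree h (w @ [i])" "u \<in> full_tree h (w @ [j])" "i \<noteq> j"
  shows "parallel v u"
  using assms by (auto simp: full_tree_def parallel_def)

definition nbrs_outside :: "nat list set \<Rightarrow> nat list set \<Rightarrow> nat list \<Rightarrow> nat list set" where
  "nbrs_outside S L x = {y \<in> S - L. parallel x y}"

text \<open>\<open>A\<close> represents \<open>k\<close> distinct rows of the cut of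
  \<open>S\<close> by \<open>L\<close>, none of them the all-ones row \<open>S - L\<close>. The
  induction alternates between \<open>E = {}\<close> and \<open>E = {{}}\<close>; the latter also
  bans the zero row. Both sides being nonempty feeds the choice of a median child.\<close>

definition many_nbrs :: "nat \<Rightarrow> nat list set set \<Rightarrow> nat list set \<Rightarrow> nat list set \<Rightarrow> bool" where
  "many_nbrs k E S L \<longleftrightarrow> S \<inter> L \<noteq> {} \<and> S - L \<noteq> {} \<and>
     (\<exists>A \<subseteq> S \<inter> L. finite A \<and> card A = k \<and> inj_on (nbrs_outside S L) A \<and>
        (\<forall>x\<in>A. nbrs_outside S L x \<notin> insert (S - L) E))"

text \<open>Take the child with the middle time. As \<open>L\<close> grows, the earlier child
  already meets \<open>L t\<close> and the later one is not yet exhausted.\<close>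

lemma median_child:
  assumes L: "mono L" and S: "\<And>i. i < 3 \<Longrightarrow> \<exists>t. many_nbrs k E (S i) (L t)"
  obtains i j l t where "i < 3" "j < 3" "l < (3::nat)" "i \<noteq> j" "l \<noteq> j"
    "many_nbrs k E (S j) (L (t :: nat))" "S i \<inter> L t \<noteq> {}" "S l - L t \<noteq> {}"
proof -
  obtain t where t: "many_nbrs k E (S i) (L (t i))" if "i < 3" for i
    using S by metis
  have "t 0 \<le> t 1 \<and> t 1 \<le> t 2 \<or> t 0 \<le> t 2 \<and> t 2 \<le> t 1 \<or> t 1 \<le> t 0 \<and> t 0 \<le> t 2 \<or>
      t 1 \<le> t 2 \<and> t 2 \<le> t 0 \<or> t 2 \<le> t 0 \<and> t 0 \<le> t 1 \<or> t 2 \<le> t 1 \<and> t 1 \<le> t 0"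
    by linarith
  moreover have "\<exists>i j l. i < 3 \<and> j < 3 \<and> l < (3::nat) \<and> i \<noteq> j \<and> l \<noteq> j \<and> t i \<le> t j \<and> t j \<le> t l"
    if "i < 3 \<and> j < 3 \<and> l < 3 \<and> i \<noteq> j \<and> l \<noteq> j" "t i \<le> t j \<and> t j \<le> t l" for i j l
    using that by blast
  note this[of 0 1 2] this[of 0 2 1] this[of 1 0 2] this[of 1 2 0] this[of 2 0 1] this[of 2 1 0]
  ultimately have "\<exists>i j l. i < 3 \<and> j < 3 \<and> l < (3::nat) \<and> i \<noteq> j \<and> l \<noteq> j \<and> t i \<le> t j \<and> t j \<le> t l"
    by (elim disjE) simp_all
  then obtain i j l where ijl: "i < 3" "j < 3" "l < (3::nat)" "i \<noteq> j" "l \<noteq> j" "t i \<le> t j" "t j \<le> t l"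
    by blast
  have "L (t i) \<subseteq> L (t j)" "L (t j) \<subseteq> L (t l)"
    using L ijl by (simp_all add: monoD)
  moreover have "S i \<inter> L (t i) \<noteq> {}" "S l - L (t l) \<noteq> {}"
    using t ijl unfolding many_nbrs_def by blast+
  ultimately have "S i \<inter> L (t j) \<noteq> {}" "S l - L (t j) \<noteq> {}"
    by blast+
  then show thesis
    using that ijl t by blast
qed

text \<open>Restriction to a child recovers the rows of the child, so rows distinct there stay
  distinct in the larger tree.\<close>

lemma nbrs_outside_child:
  assumes "j < 3"
  shows "nbrs_outside (full_tree (Suc h) w) L x \<inter> full_tree h (w @ [j]) =
    nbrs_outside (full_tree h (w @ [j])) L x"
  using full_tree_child_subset[OF assms, of h w] by (auto simp: nbrs_outside_def)

text \<open>This level gains no row but removes the zero row: a vertex of child \<open>l\<close>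
  still outside \<open>L t\<close> is adjacent to everything in child \<open>j\<close>.\<close>

lemma many_nbrs_parent:
  assumes L: "mono L" and S: "\<And>i. i < 3 \<Longrightarrow> \<exists>t. many_nbrs k {} (full_tree h (w @ [i])) (L t)"
  shows "\<exists>t :: nat. many_nbrs k {{}} (full_tree (Suc h) w) (L t)"
proof -
  let ?S = "full_tree (Suc h) w" and ?C = "\<lambda>i. full_tree h (w @ [i])"
  obtain i j l t where ijl: "i < 3" "j < 3" "l < 3" "i \<noteq> j" "l \<noteq> j"
    and j: "many_nbrs k {} (?C j) (L t)" and i: "?C i \<inter> L t \<noteq> {}" and l: "?C l - L t \<noteq> {}"
    using median_child[OF L, of k "{}" ?C] S by metis
  note sub = full_tree_child_subset[of _ h w]
  note int = nbrs_outside_child[OF ijl(2), of h w "L t"]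
  obtain A where A: "A \<subseteq> ?C j \<inter> L t" "finite A" "card A = k"
    "inj_on (nbrs_outside (?C j) (L t)) A"
    "\<And>x. x \<in> A \<Longrightarrow> nbrs_outside (?C j) (L t) x \<noteq> ?C j - L t"
  proof -
    from j obtain A where "A \<subseteq> ?C j \<inter> L t" "finite A" "card A = k"
      "inj_on (nbrs_outside (?C j) (L t)) A"
      "\<forall>x\<in>A. nbrs_outside (?C j) (L t) x \<notin> insert (?C j - L t) {}"
      unfolding many_nbrs_def by blast
    then show thesis using that[of A] by simp
  qed
  have "inj_on (nbrs_outside ?S (L t)) A"
    using A(4) int unfolding inj_on_def by metis
  moreover have "nbrs_outside ?S (L t) x \<notin> {?S - L t, {}}" if x: "x \<in> A" for x
  proof -
    have "nbrs_outside ?S (L t) x \<noteq> ?S - L t"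
      using A(5)[OF x] int[of x] sub[OF ijl(2)] by auto
    moreover have "?C l - L t \<subseteq> nbrs_outside ?S (L t) x"
      using x A(1) ijl sub[OF ijl(3)] parallel_full_tree_children[of x h w j _ l]
      by (auto simp: nbrs_outside_def)
    ultimately show ?thesis using l by blast
  qed
  moreover have "A \<subseteq> ?S \<inter> L t" "?S \<inter> L t \<noteq> {}" "?S - L t \<noteq> {}"
    using A(1) sub[OF ijl(1)] sub[OF ijl(2)] sub[OF ijl(3)] i l by blast+
  ultimately show ?thesis
    unfolding many_nbrs_def using A(2,3) by blast
qed

text \<open>The rows from the median child are neither zero nor all-ones there, so one vertex whose
  row is constant on that child adds a new row.\<close>

lemma many_nbrs_grandparent:
  assumes L: "mono L" and S: "\<And>i. i < 3 \<Longrightarrow> \<exists>t. many_nbrs k {{}} (full_tree h (w @ [i])) (L t)"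
  shows "\<exists>t :: nat. many_nbrs (Suc k) {} (full_tree (Suc h) w) (L t)"
proof -
  let ?S = "full_tree (Suc h) w" and ?C = "\<lambda>i. full_tree h (w @ [i])"
  obtain i j l t where ijl: "i < 3" "j < 3" "l < 3" "i \<noteq> j" "l \<noteq> j"
    and j: "many_nbrs k {{}} (?C j) (L t)" and i: "?C i \<inter> L t \<noteq> {}" and l: "?C l - L t \<noteq> {}"
    using median_child[OF L, of k "{{}}" ?C] S by metis
  note sub = full_tree_child_subset[of _ h w]
  note int = nbrs_outside_child[OF ijl(2), of h w "L t"]
  obtain A where A: "A \<subseteq> ?C j \<inter> L t" "finite A" "card A = k"
    "inj_on (nbrs_outside (?C j) (L t)) A"
    "\<And>x. x \<in> A \<Longrightarrow> nbrs_outside (?C j) (L t) x \<noteq> ?C j - L t"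
    "\<And>x. x \<in> A \<Longrightarrow> nbrs_outside (?C j) (L t) x \<noteq> {}"
  proof -
    from j obtain A where "A \<subseteq> ?C j \<inter> L t" "finite A" "card A = k"
      "inj_on (nbrs_outside (?C j) (L t)) A"
      "\<forall>x\<in>A. nbrs_outside (?C j) (L t) x \<notin> insert (?C j - L t) {{}}"
      unfolding many_nbrs_def by blast
    then show thesis using that[of A] by simp
  qed
  \<comment> \<open>If the root \<open>w\<close> is already in \<open>L t\<close>, it has the zero
    row on its own tree. Otherwise a vertex of child \<open>i\<close> in \<open>L t\<close> sees all
    of child \<open>j\<close> outside \<open>L t\<close>, and its row is not all-ones because it
    misses \<open>w\<close>.\<close>
  obtain z where z: "z \<in> ?S \<inter> L t" "nbrs_outside ?S (L t) z \<noteq> ?S - L t"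
    "nbrs_outside (?C j) (L t) z = ?C j - L t \<or> nbrs_outside (?C j) (L t) z = {}"
  proof (cases "w \<in> L t")
    case True
    have "nbrs_outside ?S (L t) w = {}"
      using prefix_full_tree by (auto simp: nbrs_outside_def parallel_def)
    moreover have "?S - L t \<noteq> {}"
      using l sub[OF ijl(3)] by blast
    ultimately show thesis
      using that[of w] True full_tree_root[of w "Suc h"] int[of w] by auto
  next
    case False
    obtain z where z: "z \<in> ?C i" "z \<in> L t"
      using i by blast
    have "z \<in> ?S"
      using z sub[OF ijl(1)] by blast
    have "w \<notin> nbrs_outside ?S (L t) z"
      using prefix_full_tree[OF \<open>z \<in> ?S\<close>] by (auto simp: nbrs_outside_def parallel_def)
    then have "nbrs_outside ?S (L t) z \<noteq> ?S - L t"
      using False full_tree_root[of w "Suc h"] by blast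
    moreover have "nbrs_outside (?C j) (L t) z = ?C j - L t"
      using parallel_full_tree_children[OF z(1) _ ijl(4)] by (auto simp: nbrs_outside_def)
    ultimately show thesis
      using that[of z] z \<open>z \<in> ?S\<close> by blast
  qed
  have new: "nbrs_outside ?S (L t) z \<noteq> nbrs_outside ?S (L t) x" if "x \<in> A" for x
    using A(5,6)[OF that] z(3) int[of x] int[of z] by metis
  have "inj_on (nbrs_outside ?S (L t)) A"
    using A(4) int unfolding inj_on_def by metis
  then have "inj_on (nbrs_outside ?S (L t)) (insert z A)"
    using new by auto
  moreover have "nbrs_outside ?S (L t) x \<noteq> ?S - L t" if "x \<in> insert z A" for x
  proof (cases "x = z")
    case False
    then have "x \<in> A" using that by simp
    then show ?thesis
      using A(5)[of x] int[of x] sub[OF ijl(2)] by auto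
  qed (use z in simp)
  moreover have "insert z A \<subseteq> ?S \<inter> L t" "?S \<inter> L t \<noteq> {}" "?S - L t \<noteq> {}"
    using A(1) z(1) sub[OF ijl(2)] sub[OF ijl(3)] l by blast+
  moreover have "card (insert z A) = Suc k"
    using A(2,3) new by (metis card_insert_disjoint)
  ultimately show ?thesis
    unfolding many_nbrs_def using A(2)
    by (intro exI[of _ t] conjI exI[of _ "insert z A"]) simp_all
qed

text \<open>Two levels buy one row: the first excludes the zero row, the second adds a row and drops
  that exclusion. For \<open>k = 0\<close>, height one ensures two vertices, so some
  \<open>L t\<close> splits the tree, and \<open>A\<close> is empty.\<close>

lemma full_tree_many_nbrs:
  fixes L :: "nat \<Rightarrow> nat list set"
  assumes L: "mono L"
    and sep: "\<And>v u. v \<in> W \<Longrightarrow> u \<in> W \<Longrightarrow> v \<noteq> u \<Longrightarrow> \<exists>t. (v \<in> L t) \<noteq> (u \<in> L t)"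
  shows "full_tree (2 * k + 1) w \<subseteq> W \<Longrightarrow> \<exists>t. many_nbrs k {} (full_tree (2 * k + 1) w) (L t)"
proof (induction k arbitrary: w)
  case 0
  let ?S = "full_tree (2 * 0 + 1) w"
  have mem: "w \<in> ?S" "w @ [0] \<in> ?S"
    using full_tree_root[of w 1] full_tree_child_subset[of 0 0 w] full_tree_root[of "w @ [0]" 0]
    by auto
  then obtain t where "(w \<in> L t) \<noteq> (w @ [0] \<in> L t)"
    using sep[of w "w @ [0]"] 0 by auto
  then have "?S \<inter> L t \<noteq> {}" "?S - L t \<noteq> {}"
    using mem by blast+
  then show ?case
    unfolding many_nbrs_def by (intro exI[of _ t]) (auto intro!: exI[of _ "{}"])
next
  case (Suc k)
  have "\<exists>t. many_nbrs k {{}} (full_tree (Suc (2 * k + 1)) (w @ [i])) (L t)" if i: "i < 3" for i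
  proof (rule many_nbrs_parent[OF L], rule Suc.IH)
    fix l :: nat assume "l < 3"
    then show "full_tree (2 * k + 1) ((w @ [i]) @ [l]) \<subseteq> W"
      using full_tree_child_subset[of l "2 * k + 1" "w @ [i]"]
        full_tree_child_subset[OF i, of "Suc (2 * k + 1)" w] Suc.prems by auto
  qed
  then show ?case
    using many_nbrs_grandparent[OF L, of k "Suc (2 * k + 1)" w] by simp
qed

text \<open>The initial segments of an ordering form a monotone family, so some cut has
  \<open>2 ^ c + 1\<close> distinct rows, more than cut-rank \<open>c\<close> allows.\<close>

lemma linear_rank_width_full_tree:
  "c < linear_rank_width (incomparability_graph (full_tree (2 * Suc (2 ^ c) + 1) []))"
proof -
  define k where "k = Suc (2 ^ c)"
  define W where "W = full_tree (2 * k + 1) []"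
  let ?G = "incomparability_graph W"
  have fin: "finite (pverts ?G)"
    by (simp add: W_def finite_full_tree)
  have wide: "c < ordering_width ?G xs" if "xs \<in> permutations_of_set (pverts ?G)" for xs
  proof -
    have xs: "set xs = to_nat ` W" "distinct xs"
      using that by (auto simp: permutations_of_set_def)
    define L where "L t = {v :: nat list. to_nat v \<in> set (take t xs)}" for t
    have "mono L"
      unfolding L_def by (intro monoI) (auto dest: set_take_subset_set_take[THEN subsetD])
    moreover have "\<exists>t. (v \<in> L t) \<noteq> (u \<in> L t)" if vu: "v \<in> W" "u \<in> W" "v \<noteq> u" for v u
    proof -
      have "to_nat v \<in> set xs" "to_nat u \<in> set xs" "to_nat v \<noteq> to_nat u"
        using vu xs by auto
      then obtain i j where ij: "i < length xs" "xs ! i = to_nat v"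
        "j < length xs" "xs ! j = to_nat u" "i \<noteq> j"
        by (metis in_set_conv_nth)
      have take: "xs ! m \<in> set (take n xs) \<longleftrightarrow> m < n" if "m < length xs" "n < length xs" for m n
        using that xs(2) by (auto simp: in_set_conv_nth nth_eq_iff_index_eq)
      \<comment> \<open>Positions start at 0, so the first \<open>max i j\<close> entries contain
        the earlier of the two words but not the later.\<close>
      show ?thesis
        using ij take[of i j] take[of j i] take[of i i] take[of j j] unfolding L_def
        by (intro exI[of _ "max i j"]) (auto simp: max_def)
    qed
    ultimately obtain t where "many_nbrs k {} W (L t)"
      using full_tree_many_nbrs[of L W k "[]"] unfolding W_def by blast
    then obtain A where A: "A \<subseteq> W \<inter> L t" "card A = k" "inj_on (nbrs_outside W (L t)) A"
      and L: "W \<inter> L t \<noteq> {}" "W - L t \<noteq> {}"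
      unfolding many_nbrs_def by blast
    let ?X = "set (take t xs)"
    \<comment> \<open>Both sides of the cut are nonempty, which puts \<open>t\<close> in the range
      of the maximum in \<open>ordering_width\<close>.\<close>
    have t: "t \<in> {1..length xs}"
    proof -
      have "t \<noteq> 0" using L(1) by (auto simp: L_def)
      moreover have "t < length xs"
        using L(2) xs(1) by (auto simp: L_def intro: ccontr)
      ultimately show ?thesis by simp
    qed
    let ?N = "\<lambda>x. {y \<in> pverts ?G - ?X. (x, y) \<in> parcs ?G}"
    have N: "?N (to_nat v) = to_nat ` nbrs_outside W (L t) v" if "v \<in> W" for v
      using that by (auto simp: nbrs_outside_def L_def)
    have "inj_on (?N \<circ> to_nat) A"
    proof (rule inj_onI)
      fix v u assume vu: "v \<in> A" "u \<in> A" "(?N \<circ> to_nat) v = (?N \<circ> to_nat) u"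
      then have "to_nat ` nbrs_outside W (L t) v = to_nat ` nbrs_outside W (L t) u"
        using N A(1) unfolding comp_def by blast
      then show "v = u"
        using inj_onD[OF A(3)] vu by (simp add: inj_image_eq_iff)
    qed
    then have "k = card ((?N \<circ> to_nat) ` A)"
      using A(2) by (simp only: card_image)
    also have "\<dots> = card (?N ` to_nat ` A)"
      by (simp only: image_comp)
    also have "\<dots> \<le> card (?N ` ?X)"
      using A(1) by (intro card_mono) (auto simp: L_def)
    also have "\<dots> \<le> 2 ^ cutrk ?G ?X"
      by (rule card_neighbourhoods_le_two_power_cutrk) simp
    finally have "(2::nat) ^ c < 2 ^ cutrk ?G ?X"
      by (simp only: k_def Suc_le_eq)
    then have "c < cutrk ?G ?X"
      by simp
    also have "\<dots> \<le> ordering_width ?G xs"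
      unfolding ordering_width_def using t by (intro Max_ge) auto
    finally show ?thesis .
  qed
  have "linear_rank_width ?G \<in> ordering_width ?G ` permutations_of_set (pverts ?G)"
    unfolding linear_rank_width_def using fin by (intro Min_in) auto
  then show ?thesis
    using wide unfolding W_def k_def by auto
qed

theorem theorem1p4:
  fixes T :: "'a pair_pre_digraph"
  assumes "is_tree T" and "\<not> is_caterpillar T"
  shows "\<not> (\<exists>c :: nat. \<forall>G :: nat pair_pre_digraph.
           pair_graph G \<and> distance_hereditary G \<and> pivot_minor_free T G \<longrightarrow>
           linear_rank_width G \<le> c)"
proof
  assume "\<exists>c :: nat. \<forall>G :: nat pair_pre_digraph.
    pair_graph G \<and> distance_hereditary G \<and> pivot_minor_free T G \<longrightarrow> linear_rank_width G \<le> c"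
  then obtain c where c: "linear_rank_width G \<le> c"
    if "pair_graph G" "distance_hereditary G" "pivot_minor_free T G" for G :: "nat pair_pre_digraph"
    by blast
  let ?W = "full_tree (2 * Suc (2 ^ c) + 1) []"
  obtain x a b where S: "induced_spider T x a b"
    using non_caterpillar_has_spider[OF assms] by blast
  have "pair_graph T"
    using assms(1) by (simp add: is_tree_def)
  \<comment> \<open>A pivot-minor isomorphic to \<open>T\<close> would inherit the spider of
    \<open>T\<close>.\<close>
  then have "pivot_minor_free T (incomparability_graph ?W)"
    using induced_spider_iso[OF _ _ S] incomparability_graph_no_spider[OF finite_full_tree]
    unfolding pivot_minor_free_def by blast
  then show False
    using c[of "incomparability_graph ?W"] linear_rank_width_full_tree[of c]
      pair_graph_incomparability_graph[OF finite_full_tree, of "2 * Suc (2 ^ c) + 1" "[]"]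
      distance_hereditary_incomparability_graph[OF finite_full_tree, of "2 * Suc (2 ^ c) + 1" "[]"]
    by simp
qed

end
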